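(* Let $A \in \mathrm{M}(m \times m, \mathbb{R})$ be arbitrary. For each $t \in \{1, \dots, N-1\}$, the expectations $\mu_t = \mathbb{E}(R_t)$ of the multi-step residuals and $\beta_t = \mathbb{E}(D_t)$ of the local errors satisfy $$\mu_{t+1} = A \mu_t + \beta_t .$$
   Context: Setting: $f \colon \mathbb{R}^n \to \mathbb{R}^n$ is continuous, and $X \subset \mathbb{R}^n$ is non-empty, compact and forward invariant ($x \in X$ implies $f(x) \in X$). For $\bar{x} \in X$, $x(\cdot,\bar{x}) \colon \mathbb{N}_0 \to X$ denotes the trajectory $x(0,\bar x) = \bar x$, $x(t+1,\bar x) = f(x(t,\bar x))$. The functions $\psi_1,\dots,\psi_m \in L^2(X,\mathbb{R})$ are continuous and linearly independent, and the lift $\Psi \colon X \to \mathbb{R}^m$, $\Psi(x) = (\psi_1(x),\dots,\psi_m(x))^\top$, is assumed injective. Fixed sample points $x_1,\dots,x_L \in X$ with $L \ge m$ and a fixed horizon $N \in \mathbb{N}$ ($N \geq 1$) are given, and the $m \times L$ matrix $G_0 = (\Psi(x_1)\ \cdots\ \Psi(x_L))$ is assumed to have full row rank. $\mathrm{M}(m\times m,\mathbb{R})$ is the space of real $m \times m$ matrices. For $A \in \mathrm{M}(m\times m,\mathbb{R})$, $z(\cdot,\bar x)\colon \mathbb{N}_0 \to \mathbb{R}^m$ is defined by $z(0,\bar x) = \Psi(\bar x)$, $z(t+1,\bar x) = A z(t,\bar x)$. Expectations are taken with respect to the empirical probability measure $P_L = \frac1L \sum_{i=1}^L \delta_{x_i}$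 on the Borel sets of $X$ ($\delta_{x_i}$ the Dirac measure at $x_i$), i.e. $\mathbb{E}(Y) = \frac1L\sum_{i=1}^L Y(x_i)$. Multi-step residual: $R_t \colon X \to \mathbb{R}^m$, $R_t(\bar x) = \Psi(x(t,\bar x)) - z(t,\bar x)$ for $t \in \{1,\dots,N\}$. Local error: $D_t \colon X \to \mathbb{R}^m$, $D_t(\bar x) = \Psi(x(t+1,\bar x)) - A\Psi(x(t,\bar x))$ for $t \in \{0,\dots,N-1\}$. *)

theory Defs
  imports "HOL-Probability.Probability"
begin

text \<open>
  The number of state coordinates, of observables and of sample points are the cardinalities of the
  finite index types \<open>'n\<close>, \<open>'m\<close> and \<open>'l\<close>. Functions on \<open>X\<close> are total
  functions of which only the values on \<open>X\<close> matter.
\<close>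

definition borel_on :: "'a::topological_space set \<Rightarrow> 'a measure"
  where "borel_on X = restrict_space borel X"

definition forward_invariant :: "('a \<Rightarrow> 'a) \<Rightarrow> 'a set \<Rightarrow> bool"
  where "forward_invariant f X \<longleftrightarrow> (\<forall>x\<in>X. f x \<in> X)"

primrec traj :: "('a \<Rightarrow> 'a) \<Rightarrow> nat \<Rightarrow> 'a \<Rightarrow> 'a"
  where
    "traj f 0 xbar = xbar"
  | "traj f (Suc t) xbar = f (traj f t xbar)"

definition in_L2 :: "'a measure \<Rightarrow> ('a \<Rightarrow> real) \<Rightarrow> bool"
  where "in_L2 \<nu> g \<longleftrightarrow> g \<in> borel_measurable \<nu> \<and> integrable \<nu> (\<lambda>x. (g x)\<^sup>2)"

text \<open>Elements of \<open>L\<^sup>2\<close> are classes modulo almost everywhere equality, so a linear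
  combination is zero in \<open>L\<^sup>2\<close> iff it vanishes almost everywhere.\<close>

definition lin_indep_L2 :: "'a measure \<Rightarrow> ('m::finite \<Rightarrow> 'a \<Rightarrow> real) \<Rightarrow> bool"
  where "lin_indep_L2 \<nu> \<psi> \<longleftrightarrow>
    (\<forall>c. (AE x in \<nu>. (\<Sum>j\<in>UNIV. c j * \<psi> j x) = 0) \<longrightarrow> (\<forall>j. c j = 0))"

definition lift :: "('m::finite \<Rightarrow> 'a \<Rightarrow> real) \<Rightarrow> 'a \<Rightarrow> real ^ 'm"
  where "lift \<psi> x = (\<chi> j. \<psi> j x)"

definition data_matrix :: "('m::finite \<Rightarrow> 'a \<Rightarrow> real) \<Rightarrow> ('l::finite \<Rightarrow> 'a) \<Rightarrow> real ^ 'l ^ 'm"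
  where "data_matrix \<psi> xs = (\<chi> j i. lift \<psi> (xs i) $ j)"

primrec lifted_traj ::
  "real ^ 'm ^ 'm \<Rightarrow> ('m::finite \<Rightarrow> 'a \<Rightarrow> real) \<Rightarrow> nat \<Rightarrow> 'a \<Rightarrow> real ^ 'm"
  where
    "lifted_traj A \<psi> 0 xbar = lift \<psi> xbar"
  | "lifted_traj A \<psi> (Suc t) xbar = A *v lifted_traj A \<psi> t xbar"

definition residual ::
  "('a \<Rightarrow> 'a) \<Rightarrow> ('m::finite \<Rightarrow> 'a \<Rightarrow> real) \<Rightarrow> real ^ 'm ^ 'm \<Rightarrow> nat \<Rightarrow> 'a \<Rightarrow> real ^ 'm"
  where "residual f \<psi> A t xbar = lift \<psi> (traj f t xbar) - lifted_traj A \<psi> t xbar"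

definition local_error ::
  "('a \<Rightarrow> 'a) \<Rightarrow> ('m::finite \<Rightarrow> 'a \<Rightarrow> real) \<Rightarrow> real ^ 'm ^ 'm \<Rightarrow> nat \<Rightarrow> 'a \<Rightarrow> real ^ 'm"
  where "local_error f \<psi> A t xbar =
    lift \<psi> (traj f (t + 1) xbar) - A *v lift \<psi> (traj f t xbar)"

text \<open>\<^const>\<open>return\<close> is the Dirac measure.\<close>

definition empirical_measure :: "'a::topological_space set \<Rightarrow> ('l::finite \<Rightarrow> 'a) \<Rightarrow> 'a measure"
  where "empirical_measure X xs =
    measure_of X (sets (borel_on X))
      (\<lambda>B. (\<Sum>i\<in>UNIV. emeasure (return (borel_on X) (xs i)) B) / of_nat CARD('l))"

lemma space_borel_on [simp]: "space (borel_on X) = X"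
  by (simp add: borel_on_def space_restrict_space)

lemma empirical_measure_eq_distr:
  fixes xs :: "'l::finite \<Rightarrow> 'a::topological_space"
  assumes xs: "\<And>i. xs i \<in> X"
  shows "empirical_measure X xs = distr (uniform_count_measure UNIV) (borel_on X) xs"
proof -
  let ?U = "uniform_count_measure (UNIV :: 'l set)"
  let ?D = "distr ?U (borel_on X) xs"
  have meas: "xs \<in> measurable ?U (borel_on X)"
    using xs by (auto simp: measurable_def space_uniform_count_measure sets_uniform_count_measure)
  have eq: "(\<Sum>i\<in>UNIV. emeasure (return (borel_on X) (xs i)) B) / of_nat CARD('l) = emeasure ?D B"
    if B: "B \<in> sets (borel_on X)" for B
  proof -
    have "(\<Sum>i\<in>UNIV. emeasure (return (borel_on X) (xs i)) B) = of_nat (card (xs -` B))"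
      using B by (simp add: indicator_def of_bool_def sum.If_cases vimage_def)
    moreover have "emeasure ?D B = of_nat (card (xs -` B)) / of_nat CARD('l)"
      using B meas
      by (simp add: emeasure_distr space_uniform_count_measure emeasure_uniform_count_measure
          divide_ennreal ennreal_of_nat_eq_real_of_nat)
    ultimately show ?thesis by simp
  qed
  have "empirical_measure X xs = measure_of X (sets (borel_on X)) (emeasure ?D)"
    unfolding empirical_measure_def
    by (rule measure_of_eq) (use eq sets.space_closed[of "borel_on X"] sets.sigma_sets_eq[of "borel_on X"] in auto)
  also have "\<dots> = ?D"
    using measure_of_of_measure[of ?D] by simp
  finally show ?thesis .
qed

lemma prob_space_empirical_measure:
  fixes xs :: "'l::finite \<Rightarrow> 'a::topological_space"
  assumes xs: "\<And>i. xs i \<in> X"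
  shows "prob_space (empirical_measure X xs)"
  unfolding empirical_measure_eq_distr[OF xs]
  by (rule prob_space.prob_space_distr)
     (use xs in \<open>auto simp: measurable_def space_uniform_count_measure sets_uniform_count_measure
        intro!: prob_space_uniform_count_measure\<close>)

lemma integral_empirical_measure:
  fixes xs :: "'l::finite \<Rightarrow> 'a::topological_space"
    and Y :: "'a \<Rightarrow> 'b::euclidean_space"
  assumes xs: "\<And>i. xs i \<in> X" and Y: "Y \<in> borel_measurable (borel_on X)"
  shows "integral\<^sup>L (empirical_measure X xs) Y = (1 / real CARD('l)) *\<^sub>R (\<Sum>i\<in>UNIV. Y (xs i))"
proof -
  have "xs \<in> measurable (uniform_count_measure UNIV) (borel_on X)"
    using xs by (auto simp: measurable_def space_uniform_count_measure sets_uniform_count_measure)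
  then show ?thesis
    unfolding empirical_measure_eq_distr[OF xs]
    using Y by (simp add: integral_distr uniform_count_measure_def lebesgue_integral_point_measure_finite scaleR_sum_right)
qed

end

theory Submission
  imports Defs
begin

text \<open>
  The recursion already holds pointwise: adding and subtracting \<open>A \<Psi>(x(t))\<close> splits the
  residual at time \<open>t + 1\<close> into the local error committed in the last step and the image under
  \<open>A\<close> of the residual accumulated so far (\<open>residual_Suc\<close>). Taking expectations
  preserves this identity because \<open>A\<close> is linear.

  The Bochner integral of a non-measurable function is zero by default, so identifying the
  expectations with the averages over the samples requires residuals and local errors to be Borel on
  \<open>X\<close>. This is where continuity and forward invariance enter: since the trajectory never
  leaves \<open>X\<close>, the functions involved are composed of maps that are continuous on
  \<open>X\<close>, hence are continuous there themselves.
\<close>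

lemma traj_in_forward_invariant:
  assumes "forward_invariant f X" and "x \<in> X"
  shows "traj f t x \<in> X"
  using assms by (induction t) (auto simp: forward_invariant_def)

lemma continuous_on_traj:
  assumes f: "continuous_on X f" and X: "forward_invariant f X"
  shows "continuous_on X (traj f t)"
proof (induction t)
  case (Suc t)
  have "traj f t ` X \<subseteq> X"
    using traj_in_forward_invariant[OF X] by blast
  then show ?case
    using continuous_on_compose2[OF f Suc] by simp
qed simp

lemma continuous_on_lift:
  assumes "\<And>j. continuous_on X (\<psi> j)"
  shows "continuous_on X (lift \<psi>)"
  unfolding lift_def [abs_def] by (intro continuous_on_vec_lambda assms)

lemma continuous_on_lift_traj:
  assumes "continuous_on X f" and "forward_invariant f X" and "\<And>j. continuous_on X (\<psi> j)"
  shows "continuous_on X (\<lambda>x. lift \<psi> (traj f t x))"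
proof (rule continuous_on_compose2[where g = "lift \<psi>" and f = "traj f t"])
  show "continuous_on X (lift \<psi>)"
    using assms(3) by (rule continuous_on_lift)
  show "continuous_on X (traj f t)"
    using assms(1,2) by (rule continuous_on_traj)
  show "traj f t ` X \<subseteq> X"
    using traj_in_forward_invariant[OF assms(2)] by blast
qed

lemma continuous_on_matrix_vector_mult:
  fixes A :: "real ^ 'm ^ 'k" and g :: "'a::topological_space \<Rightarrow> real ^ 'm"
  assumes "continuous_on X g"
  shows "continuous_on X (\<lambda>x. A *v g x)"
  using assms by (rule bounded_linear.continuous_on[OF matrix_vector_mul_bounded_linear])

lemma continuous_on_lifted_traj:
  assumes "\<And>j. continuous_on X (\<psi> j)"
  shows "continuous_on X (lifted_traj A \<psi> t)"
  by (induction t) (simp_all add: continuous_on_lift assms continuous_on_matrix_vector_mult)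

lemma continuous_on_residual:
  assumes "continuous_on X f" and "forward_invariant f X" and "\<And>j. continuous_on X (\<psi> j)"
  shows "continuous_on X (residual f \<psi> A t)"
  unfolding residual_def
  by (intro continuous_on_diff continuous_on_lift_traj continuous_on_lifted_traj assms)

lemma continuous_on_local_error:
  assumes "continuous_on X f" and "forward_invariant f X" and "\<And>j. continuous_on X (\<psi> j)"
  shows "continuous_on X (local_error f \<psi> A t)"
  unfolding local_error_def
  by (intro continuous_on_diff continuous_on_matrix_vector_mult continuous_on_lift_traj assms)

lemma integral_empirical_measure_continuous:
  fixes xs :: "'l::finite \<Rightarrow> 'a::topological_space"
    and Y :: "'a \<Rightarrow> 'b::euclidean_space"
  assumes "\<And>i. xs i \<in> X" and "continuous_on X Y"
  shows "integral\<^sup>L (empirical_measure X xs) Y = (1 / real CARD('l)) *\<^sub>R (\<Sum>i\<in>UNIV. Y (xs i))"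
  using assms
  by (intro integral_empirical_measure) (auto simp: borel_on_def borel_measurable_continuous_on_restrict)

text \<open>Inserting \<open>A \<Psi>(x(t))\<close> between \<open>\<Psi>(x(t + 1))\<close> and
  \<open>z(t + 1) = A z(t)\<close> separates the newly made error from the propagated one.\<close>

lemma residual_Suc:
  "residual f \<psi> A (Suc t) x = A *v residual f \<psi> A t x + local_error f \<psi> A t x"
  by (simp add: residual_def local_error_def matrix_vector_mult_diff_distrib)

theorem proposition2:
  fixes f :: "real ^ 'n \<Rightarrow> real ^ 'n"
    and X :: "(real ^ 'n) set"
    and \<nu> :: "(real ^ 'n) measure"
    and \<psi> :: "'m::finite \<Rightarrow> real ^ 'n \<Rightarrow> real"
    and xs :: "'l::finite \<Rightarrow> real ^ 'n"
    and N :: nat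
    and A :: "real ^ 'm ^ 'm"
  assumes "continuous_on UNIV f"
    and "X \<noteq> {}" and "compact X" and "forward_invariant f X"
    and "sets \<nu> = sets (borel_on X)"
    and "\<And>j. in_L2 \<nu> (\<psi> j)"
    and "\<And>j. continuous_on X (\<psi> j)"
    and "lin_indep_L2 \<nu> \<psi>"
    and "inj_on (lift \<psi>) X"
    and "\<And>i. xs i \<in> X"
    and "CARD('l) \<ge> CARD('m)"
    and "N \<ge> 1"
    and "rank (data_matrix \<psi> xs) = CARD('m)"
  shows "\<forall>t\<in>{1..<N}.
    integral\<^sup>L (empirical_measure X xs) (residual f \<psi> A (t + 1)) =
      A *v integral\<^sup>L (empirical_measure X xs) (residual f \<psi> A t)
      + integral\<^sup>L (empirical_measure X xs) (local_error f \<psi> A t)"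
proof
  fix t
  note xs = \<open>\<And>i. xs i \<in> X\<close>
  have f: "continuous_on X f"
    using \<open>continuous_on UNIV f\<close> by (rule continuous_on_subset) simp
  note cont = f \<open>forward_invariant f X\<close> \<open>\<And>j. continuous_on X (\<psi> j)\<close>
  note mean_residual =
    integral_empirical_measure_continuous[OF xs continuous_on_residual[OF cont]]
  note mean_local_error =
    integral_empirical_measure_continuous[OF xs continuous_on_local_error[OF cont]]
  have A_sum: "A *v (\<Sum>i\<in>UNIV. g i) = (\<Sum>i\<in>UNIV. A *v g i)" for g :: "'l \<Rightarrow> real ^ 'm"
    by (rule linear_sum[OF matrix_vector_mul_linear])
  show "integral\<^sup>L (empirical_measure X xs) (residual f \<psi> A (t + 1)) =
      A *v integral\<^sup>L (empirical_measure X xs) (residual f \<psi> A t)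
      + integral\<^sup>L (empirical_measure X xs) (local_error f \<psi> A t)"
    unfolding mean_residual mean_local_error
    by (simp add: residual_Suc sum.distrib A_sum matrix_vector_mult_scaleR scaleR_add_right)
qed

end
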